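(* There exists an infinite word over a 3-letter alphabet that simultaneously avoids the two formulas with reversal $xyzx\cdot yzxy\cdot z^R$ and $xyzx\cdot yz^Rxy$.
   Context: A formula with reversal is a finite set of words (called fragments, written separated by dots) over an alphabet of variables, where each variable $x$ may occur either as $x$ or as $x^R$. An occurrence of a formula with reversal $F$ in a word $w$ is a map $h$ assigning to each variable a nonempty word, extended to fragments by concatenation with the convention $h(x^R)=h(x)^R$ (the reverse, i.e. mirror image, of $h(x)$), such that $h(f)$ is a factor of $w$ for every fragment $f$ of $F$. A word avoids $F$ if it contains no occurrence of $F$. *)

theory Defs
  imports "HOL-Library.FSet" "HOL-Library.Omega_Words_Fun"
begin

datatype 'v symbol = Var 'v | Rev 'v

type_synonym 'v fragment = "'v symbol list"
type_synonym 'v formula = "'v fragment fset"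

fun subst_symbol :: "('v \<Rightarrow> 'a list) \<Rightarrow> 'v symbol \<Rightarrow> 'a list" where
  "subst_symbol h (Var x) = h x"
| "subst_symbol h (Rev x) = rev (h x)"

definition subst_fragment :: "('v \<Rightarrow> 'a list) \<Rightarrow> 'v fragment \<Rightarrow> 'a list" where
  "subst_fragment h f = concat (map (subst_symbol h) f)"

definition is_factor :: "'a list \<Rightarrow> 'a word \<Rightarrow> bool" where
  "is_factor u w \<longleftrightarrow> (\<exists>i j. u = w [i \<rightarrow> j])"

definition is_occurrence :: "('v \<Rightarrow> 'a list) \<Rightarrow> 'v formula \<Rightarrow> 'a word \<Rightarrow> bool" where
  "is_occurrence h F w \<longleftrightarrow>
     (\<forall>x. h x \<noteq> []) \<and> (\<forall>f. f |\<in>| F \<longrightarrow> is_factor (subst_fragment h f) w)"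

definition avoids :: "'a word \<Rightarrow> 'v formula \<Rightarrow> bool" where
  "avoids w F \<longleftrightarrow> \<not> (\<exists>h. is_occurrence h F w)"

datatype var = X | Y | Z

definition formula_A :: "var formula" where
  "formula_A = {| [Var X, Var Y, Var Z, Var X], [Var Y, Var Z, Var X, Var Y], [Rev Z] |}"

definition formula_B :: "var formula" where
  "formula_B = {| [Var X, Var Y, Var Z, Var X], [Var Y, Rev Z, Var X, Var Y] |}"

end

theory Submission
  imports Defs
begin

text \<open>
  An occurrence of either formula consists of factors \<open>xyzx\<close> and \<open>yz'xy\<close> with \<open>z' \<in> {z, z\<^sup>R}\<close>
  of a word in which \<open>z\<close> and \<open>z\<^sup>R\<close> both occur. In the word constructed here a factor whose
  reversal is also a factor has length at most 4. Hence \<open>x\<close> and \<open>y\<close> nearly fill the period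
  \<open>p = |xyz|\<close>, and one of the two factors is a repetition of period \<open>p\<close> that is prolonged by
  \<open>a \<ge> (p - 4) / 2\<close> letters. There are no such repetitions with \<open>p \<ge> 19\<close>, and the shorter ones
  are inspected one by one.

  The word is the concatenation of blocks of length 20. The \<open>n\<close>-th block is chosen between two
  alternatives that depend on \<open>n mod 3\<close>, according to the \<open>n\<close>-th bit of a generalised
  Thue--Morse word, the fixed point of a morphism \<open>b \<mapsto> b \<oplus> seed\<close> of length 14. Windows of length
  18 determine the position modulo 60, so that long repetitions come from repetitions of the bits
  whose period is a multiple of 3. As 3 and 14 are coprime, these desubstitute to shorter ones of
  the same kind, and they are all shorter than one and a half periods. The seed and the blocks were
  found by a computer search. The finite checks treat every sequence of bits, not only those that
  are factors of the binary word.
\<close>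

section \<open>Repetitions and windows\<close>

definition repeats :: "(nat \<Rightarrow> 'a) \<Rightarrow> nat \<Rightarrow> nat \<Rightarrow> nat \<Rightarrow> bool" where
  "repeats f p a i \<longleftrightarrow> (\<forall>t<a. f (i + t) = f (i + p + t))"

lemma repeats_mono: "repeats f p a i \<Longrightarrow> a' \<le> a \<Longrightarrow> repeats f p a' i"
  by (auto simp: repeats_def)

text \<open>The checking functions use conditionals instead of connectives, so that evaluation by rewriting
  is lazy.\<close>

fun agree :: "nat \<Rightarrow> 'a list \<Rightarrow> 'a list \<Rightarrow> bool" where
  "agree 0 xs ys = True"
| "agree (Suc n) (x # xs) (y # ys) = (if x = y then agree n xs ys else False)"
| "agree (Suc n) xs ys = (xs = ys)"

lemma agree_if_nth_eq:
  assumes "n \<le> length xs" "n \<le> length ys" "\<And>t. t < n \<Longrightarrow> xs ! t = ys ! t"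
  shows "agree n xs ys"
  using assms
proof (induction n xs ys rule: agree.induct)
  case (2 n x xs y ys)
  have "xs ! t = ys ! t" if "t < n" for t
    using "2.prems"(3)[of "Suc t"] that by simp
  then show ?case
    using "2.IH" "2.prems"(1,2) "2.prems"(3)[of 0] by simp
qed simp_all

text \<open>The first argument of \<open>Q\<close> counts down: it is \<open>n - 1 - r\<close> for \<open>drop r xs\<close>.\<close>

fun all_drops :: "nat \<Rightarrow> (nat \<Rightarrow> 'a list \<Rightarrow> bool) \<Rightarrow> 'a list \<Rightarrow> bool" where
  "all_drops 0 Q xs = True"
| "all_drops (Suc n) Q xs = (if Q n xs then all_drops n Q (tl xs) else False)"

lemma all_dropsD: "all_drops n Q xs \<Longrightarrow> r < n \<Longrightarrow> Q (n - Suc r) (drop r xs)"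
proof (induction n arbitrary: xs r)
  case (Suc n)
  then show ?case
    by (cases r) (auto split: if_splits simp: drop_Suc)
qed simp

lemma uniform_concat:
  assumes "\<And>n r. r < q \<Longrightarrow> f (q * n + r) = Blk n ! r" and "\<And>n. length (Blk n) = q"
  shows "concat (map Blk [n..<n + k]) = map f [q * n..<q * n + q * k]"
proof (induction k)
  case (Suc k)
  have "Blk (n + k) = map f [q * (n + k)..<q * (n + k) + q]"
    by (rule nth_equalityI) (simp_all add: assms)
  moreover have "[q * n..<q * n + q * Suc k] =
      [q * n..<q * n + q * k] @ [q * (n + k)..<q * (n + k) + q]"
    using upt_add_eq_append[of "q * n" "q * n + q * k" q] by (simp add: algebra_simps)
  ultimately show ?case
    using Suc by simp
qed simp

lemma nth_uniform_window:
  assumes "\<And>n r. r < q \<Longrightarrow> f (q * n + r) = Blk n ! r" and "\<And>n. length (Blk n) = q"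
    and "t < q * k - r"
  shows "drop r (concat (map Blk [n..<n + k])) ! t = f (q * n + r + t)"
  using assms(3) by (simp add: uniform_concat[OF assms(1,2)] add.assoc)

section \<open>The binary word\<close>

definition seed :: "bool list" where
  "seed = [False, False, True, True, True, False, True, False, True, False, False, False, True, True]"

definition bit_block :: "bool \<Rightarrow> bool list" where
  "bit_block b = map (\<lambda>c. b \<noteq> c) seed"

text \<open>The case \<open>n = 0\<close> makes the recursion terminate. It agrees with the general
  rule because \<open>seed\<close> begins with \<open>False\<close>, so \<open>bits_rec\<close>
  holds for every \<open>n\<close>.\<close>

fun bits :: "nat \<Rightarrow> bool" where
  "bits n = (if n = 0 then False else bits (n div 14) \<noteq> seed ! (n mod 14))"

declare bits.simps [simp del]

lemma length_bit_block [simp]: "length (bit_block b) = 14"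
  by (simp add: bit_block_def seed_def)

lemma bits_rec: "bits n = (bits (n div 14) \<noteq> seed ! (n mod 14))"
  by (subst bits.simps, cases "n = 0") (simp_all add: seed_def bits.simps[of 0])

lemma bits_uniform: "r < 14 \<Longrightarrow> bits (14 * n + r) = bit_block (bits n) ! r"
  using length_bit_block[of "bits n"] by (subst bits_rec) (simp add: bit_block_def)

text \<open>From any of the 14 offsets, three consecutive blocks leave at least 42 - 13 = 29
  letters. A check over all triples of bits therefore covers every window of that length.\<close>

lemma bit_window:
  assumes "list_all (\<lambda>b. list_all (\<lambda>b'. list_all (\<lambda>b''.
      all_drops 14 Q (bit_block b @ bit_block b' @ bit_block b'')) [False, True]) [False, True])
      [False, True]"
  obtains u where "Q (13 - i mod 14) u" "29 \<le> length u" "\<And>t. t < 29 \<Longrightarrow> u ! t = bits (i + t)"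
proof -
  let ?n = "i div 14" and ?r = "i mod 14"
  let ?v = "concat (map (\<lambda>n. bit_block (bits n)) [?n..<?n + 3])"
  have v: "?v = bit_block (bits ?n) @ bit_block (bits (Suc ?n)) @ bit_block (bits (Suc (Suc ?n)))"
    by (simp add: numeral_3_eq_3)
  have "all_drops 14 Q (bit_block b @ bit_block b' @ bit_block b'')" for b b' b''
    using assms by (cases b; cases b'; cases b'') simp_all
  then have "all_drops 14 Q ?v"
    unfolding v .
  from all_dropsD[OF this, of ?r] have "Q (13 - ?r) (drop ?r ?v)"
    by simp
  moreover have "?r < 14"
    by simp
  then have "29 \<le> length (drop ?r ?v)"
    unfolding v by simp
  moreover have "drop ?r ?v ! t = bits (i + t)" if "t < 29" for t
  proof -
    have "t < 14 * 3 - ?r"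
      using that \<open>?r < 14\<close> by linarith
    then show ?thesis
      using nth_uniform_window[of 14 bits "\<lambda>n. bit_block (bits n)" t 3 ?r ?n]
      by (simp add: bits_uniform)
  qed
  ultimately show thesis
    using that by blast
qed

lemma bit_sync_check:
  "list_all (\<lambda>b. list_all (\<lambda>b'. list_all (\<lambda>b''. all_drops 14
    (\<lambda>r u. list_all (\<lambda>c. list_all (\<lambda>c'. all_drops 14
      (\<lambda>r' u'. if agree 7 u u' then r = r' else True) (bit_block c @ bit_block c'))
      [False, True]) [False, True])
    (bit_block b @ bit_block b' @ bit_block b'')) [False, True]) [False, True]) [False, True]"
  by code_simp

text \<open>The periods are the multiples of 3 up to 12, each with the least \<open>a\<close> such
  that \<open>2 * a \<ge> p\<close>.\<close>

lemma bit_short_check: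
  "list_all (\<lambda>b. list_all (\<lambda>b'. list_all (\<lambda>b''. all_drops 14
    (\<lambda>r u. \<not> agree 2 u (drop 3 u) \<and> \<not> agree 3 u (drop 6 u) \<and>
      \<not> agree 5 u (drop 9 u) \<and> \<not> agree 6 u (drop 12 u))
    (bit_block b @ bit_block b' @ bit_block b'')) [False, True]) [False, True]) [False, True]"
  by code_simp

text \<open>By \<open>bit_sync_check\<close> seven letters fix the position modulo 14, and the
  windows at \<open>i\<close> and \<open>i + p\<close> are equal.\<close>

lemma bits_sync:
  assumes "repeats bits p 7 i"
  shows "14 dvd p"
proof -
  let ?j = "i + p"
  let ?n = "?j div 14" and ?r = "?j mod 14"
  let ?v = "bit_block (bits ?n) @ bit_block (bits (Suc ?n))"
  obtain u where u: "list_all (\<lambda>c. list_all (\<lambda>c'. all_drops 14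
      (\<lambda>r' u'. if agree 7 u u' then 13 - i mod 14 = r' else True) (bit_block c @ bit_block c'))
      [False, True]) [False, True]"
    and len: "29 \<le> length u" and nth: "\<And>t. t < 29 \<Longrightarrow> u ! t = bits (i + t)"
    by (rule bit_window[OF bit_sync_check, where i = i]) (rule that)
  have "all_drops 14 (\<lambda>r' u'. if agree 7 u u' then 13 - i mod 14 = r' else True)
      (bit_block c @ bit_block c')" for c c'
    using u by (cases c; cases c') simp_all
  from all_dropsD[OF this, of ?r "bits ?n" "bits (Suc ?n)"]
  have *: "agree 7 u (drop ?r ?v) \<Longrightarrow> 13 - i mod 14 = 13 - ?r"
    by (simp split: if_splits)
  have v: "?v = concat (map (\<lambda>n. bit_block (bits n)) [?n..<?n + 2])"
    by (simp add: numeral_2_eq_2)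
  have r: "?r < 14"
    by simp
  have "drop ?r ?v ! t = bits (?j + t)" if "t < 7" for t
  proof -
    have "t < 14 * 2 - ?r"
      using that r by linarith
    then show ?thesis
      using nth_uniform_window[of 14 bits "\<lambda>n. bit_block (bits n)" t 2 ?r ?n]
      unfolding v by (simp add: bits_uniform)
  qed
  then have "agree 7 u (drop ?r ?v)"
    using assms len r by (intro agree_if_nth_eq) (simp_all add: nth repeats_def)
  then have "13 - i mod 14 = 13 - ?r"
    by (rule *)
  moreover have "i mod 14 < 14"
    by simp
  ultimately have "i mod 14 = ?r"
    using r by linarith
  then show ?thesis
    using mod_eq_dvd_iff_nat[of i ?j 14] by simp
qed

lemma bits_no_short_repetition:
  assumes "repeats bits p a i" "(p, a) \<in> {(3, 2), (6, 3), (9, 5), (12, 6)}"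
  shows False
proof -
  obtain u where u: "\<not> agree 2 u (drop 3 u) \<and> \<not> agree 3 u (drop 6 u) \<and>
      \<not> agree 5 u (drop 9 u) \<and> \<not> agree 6 u (drop 12 u)"
    and len: "29 \<le> length u" and nth: "\<And>t. t < 29 \<Longrightarrow> u ! t = bits (i + t)"
    by (rule bit_window[OF bit_short_check, where i = i]) (rule that)
  have "agree a u (drop p u)"
    using assms len by (intro agree_if_nth_eq) (auto simp: nth repeats_def add.assoc)
  then show False
    using u assms(2) by auto
qed

text \<open>The two values of \<open>bit_block\<close> differ at every position, so a single letter
  and its offset reveal the bit. Hence every block that meets the repeated range counts, even if
  only partly covered.\<close>

lemma bits_desubstitute:
  assumes "repeats bits (14 * p) a i" "0 < a"
  obtains a' i' where "repeats bits p a' i'" "a \<le> 14 * a'"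
proof
  define m d where "m = i div 14" and "d = (i + a - 1) div 14"
  have m: "14 * m \<le> i"
    by (simp add: m_def)
  have d: "14 * d \<le> i + a - 1" "i + a - 1 < 14 * d + 14"
    unfolding d_def by linarith+
  have "m \<le> d"
    unfolding m_def d_def using assms(2) by (intro div_le_mono) simp
  then show "a \<le> 14 * Suc (d - m)"
    using m d by (simp add: diff_mult_distrib2)
  have "bits (m + t) = bits (m + p + t)" if "t < Suc (d - m)" for t
  proof -
    \<comment> \<open>The first position of block \<open>m + t\<close> inside the repeated
      range.\<close>
    define n where "n = max i (14 * (m + t))"
    have "14 * (m + t) \<le> 14 * d"
      using that \<open>m \<le> d\<close> by simp
    then have n: "i \<le> n" "n < i + a"
      using d(1) assms(2) unfolding n_def by linarith+
    have "n div 14 = m + t"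
      unfolding n_def m_def by (auto simp: max_def)
    moreover have "bits n = bits (n + 14 * p)"
      using assms(1)[unfolded repeats_def, rule_format, of "n - i"] n by (simp add: add.commute)
    ultimately show ?thesis
      using bits_rec[of n] bits_rec[of "n + 14 * p"] by (auto simp: ac_simps)
  qed
  then show "repeats bits p (Suc (d - m)) m"
    by (simp add: repeats_def)
qed

text \<open>Descent on \<open>p\<close>: if 14 divides \<open>p\<close>, desubstitution gives the
  period \<open>p div 14\<close>, still a multiple of 3. Otherwise synchronisation forces
  \<open>a < 7\<close>, so a counterexample has \<open>p \<le> 12\<close> and is ruled out by
  inspection.\<close>

lemma bits_repetition_short:
  assumes "repeats bits p a i" "3 dvd p" "0 < p"
  shows "2 * a < p"
  using assms
proof (induction p arbitrary: a i rule: less_induct)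
  case (less p)
  show ?case
  proof (cases "14 dvd p")
    case True
    then obtain p' where p': "p = 14 * p'"
      by blast
    have "3 dvd 14 * p'"
      using less.prems(2) p' by simp
    then have "3 dvd p'"
      by presburger
    show ?thesis
    proof (cases "a = 0")
      case False
      with less.prems(1) obtain a' i' where "repeats bits p' a' i'" "a \<le> 14 * a'"
        using bits_desubstitute p' by blast
      then show ?thesis
        using less.IH[of p' a' i'] p' \<open>3 dvd p'\<close> less.prems(3) by simp
    qed (use less.prems in simp)
  next
    case False
    have "a < 7"
      using False bits_sync repeats_mono[OF less.prems(1), of 7] by (meson not_le)
    show ?thesis
    proof (rule ccontr)
      assume "\<not> 2 * a < p"
      then have "p \<le> 12"
        using \<open>a < 7\<close> by simp
      then have "p = 3 \<or> p = 6 \<or> p = 9 \<or> p = 12"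
        using less.prems(2,3) by presburger
      then obtain a' where "(p, a') \<in> {(3, 2), (6, 3), (9, 5), (12, 6)}" "a' \<le> a"
        using \<open>\<not> 2 * a < p\<close> by auto
      then show False
        using bits_no_short_repetition repeats_mono[OF less.prems(1)] by blast
    qed
  qed
qed

section \<open>The ternary word\<close>

datatype letter = A | B | C

fun block :: "nat \<Rightarrow> bool \<Rightarrow> letter list" where
  "block 0 False =
     [A, B, B, B, C, C, A, C, A, B, C, B, C, C, C, A, B, A, B, B]"
| "block 0 True =
     [A, B, B, C, B, C, A, C, A, A, B, C, B, C, C, C, A, B, A, B]"
| "block (Suc 0) False =
     [C, B, C, C, A, A, A, B, B, B, C, B, C, A, C, A, A, A, B, C]"
| "block (Suc 0) True =
     [B, C, B, C, A, C, A, A, A, B, C, B, C, C, A, C, A, A, B, B]"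
| "block (Suc (Suc _)) False =
     [B, C, C, C, A, C, A, B, A, B, B, B, C, B, C, C, C, A, C, B]"
| "block (Suc (Suc _)) True =
     [B, C, C, C, A, C, B, A, A, B, B, B, C, B, C, C, A, C, A, B]"

fun next_phase :: "nat \<Rightarrow> nat" where
  "next_phase 0 = Suc 0"
| "next_phase (Suc 0) = Suc (Suc 0)"
| "next_phase (Suc (Suc _)) = 0"

definition phases :: "nat list" where
  "phases = [0, Suc 0, Suc (Suc 0)]"

definition letters :: "nat \<Rightarrow> letter" where
  "letters n = block (n div 20 mod 3) (bits (n div 20)) ! (n mod 20)"

lemma mod_3_in_phases: "n mod 3 \<in> set phases"
  unfolding phases_def by (simp, presburger)

lemma next_phase_mod_3: "next_phase (n mod 3) = Suc n mod 3"
proof -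
  consider "n mod 3 = 0" | "n mod 3 = Suc 0" | "n mod 3 = Suc (Suc 0)"
    using mod_3_in_phases[of n] by (auto simp: phases_def)
  then show ?thesis
    by cases (simp_all add: mod_Suc)
qed

lemma length_block [simp]: "length (block c b) = 20"
  by (cases "(c, b)" rule: block.cases) simp_all

lemma block_not_Nil [simp]: "block c b \<noteq> []"
  by (metis length_block list.size(3) zero_neq_numeral)

lemma letters_uniform: "r < 20 \<Longrightarrow> letters (20 * n + r) = block (n mod 3) (bits n) ! r"
  by (simp add: letters_def)

fun chains :: "nat \<Rightarrow> nat \<Rightarrow> letter list list" where
  "chains 0 c = [[]]"
| "chains (Suc k) c =
    concat (map (\<lambda>v. [block c False @ v, block c True @ v]) (chains k (next_phase c)))"

lemma concat_blocks_in_chains: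
  "concat (map (\<lambda>n. block (n mod 3) (bits n)) [n..<n + k]) \<in> set (chains k (n mod 3))"
proof (induction k arbitrary: n)
  case (Suc k)
  have "[n..<n + Suc k] = n # [Suc n..<Suc n + k]"
    by (simp add: upt_conv_Cons)
  then show ?case
    using Suc[of "Suc n"] by (cases "bits n") (auto simp: next_phase_mod_3)
qed simp

definition all_windows :: "nat \<Rightarrow> (nat \<Rightarrow> nat \<Rightarrow> letter list \<Rightarrow> bool) \<Rightarrow> bool" where
  "all_windows k Q = list_all (\<lambda>c. list_all (all_drops 20 (Q c)) (chains k c)) phases"

text \<open>The worst offset is 19, which leaves \<open>20 * k - 19\<close> letters of
  \<open>k\<close> blocks.\<close>

lemma all_windowsE:
  assumes "all_windows k Q"
  obtains u where "Q (i div 20 mod 3) (19 - i mod 20) u" "20 * k - 19 \<le> length u"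
    "\<And>t. t < 20 * k - 19 \<Longrightarrow> u ! t = letters (i + t)"
proof -
  let ?n = "i div 20" and ?r = "i mod 20"
  let ?v = "concat (map (\<lambda>n. block (n mod 3) (bits n)) [?n..<?n + k])"
  have "all_drops 20 (Q (?n mod 3)) ?v"
    using assms mod_3_in_phases[of ?n] concat_blocks_in_chains[of ?n k]
    by (auto simp: all_windows_def list_all_iff)
  from all_dropsD[OF this, of ?r] have "Q (?n mod 3) (19 - ?r) (drop ?r ?v)"
    by simp
  moreover have r: "?r < 20"
    by simp
  have "length ?v = 20 * k"
    by (subst uniform_concat[where q = 20 and f = letters]) (simp_all add: letters_uniform)
  then have "20 * k - 19 \<le> length (drop ?r ?v)"
    using r by simp
  moreover have "drop ?r ?v ! t = letters (i + t)" if "t < 20 * k - 19" for t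
  proof -
    have "t < 20 * k - ?r"
      using that r by linarith
    then show ?thesis
      using nth_uniform_window[of 20 letters "\<lambda>n. block (n mod 3) (bits n)" t k ?r ?n]
      by (simp add: letters_uniform)
  qed
  ultimately show thesis
    using that by blast
qed

text \<open>\<open>fits c xs ys\<close> means that \<open>ys\<close> can be read from the rest \<open>xs\<close> of a block and the subsequent
  blocks, of which the first has phase \<open>c\<close>.\<close>

fun fits :: "nat \<Rightarrow> letter list \<Rightarrow> letter list \<Rightarrow> bool" where
  "fits c xs [] = True"
| "fits c (x # xs) (y # ys) = (if x = y then fits c xs ys else False)"
| "fits c [] (y # ys) =
    ((if y = hd (block c False) then fits (next_phase c) (tl (block c False)) ys else False) \<or>
     (if y = hd (block c True) then fits (next_phase c) (tl (block c True)) ys else False))"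

text \<open>The actual bits select a branch that \<open>fits\<close> accepts. Allowing
  \<open>r = 20\<close>, an exhausted block, lets the induction cross block boundaries.\<close>

lemma fits_letters:
  "r \<le> 20 \<Longrightarrow> fits (Suc n mod 3) (drop r (block (n mod 3) (bits n)))
    (map letters [20 * n + r..<20 * n + r + l])"
proof (induction l arbitrary: n r)
  case (Suc l)
  let ?i = "20 * n + r"
  have map: "map letters [?i..<?i + Suc l] = letters ?i # map letters [Suc ?i..<Suc ?i + l]"
    by (simp add: upt_conv_Cons del: upt_Suc)
  show ?case
  proof (cases "r < 20")
    case True
    then have "drop r (block (n mod 3) (bits n)) =
        letters ?i # drop (Suc r) (block (n mod 3) (bits n))"
      by (simp add: Cons_nth_drop_Suc letters_uniform)
    then show ?thesis
      using Suc.IH[of "Suc r" n] True unfolding map by simp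
  next
    case False
    let ?m = "Suc n"
    have r: "r = 20"
      using False Suc.prems by simp
    have hd: "letters ?i = hd (block (?m mod 3) (bits ?m))"
      using letters_uniform[of 0 ?m] by (simp add: r hd_conv_nth add.commute)
    have "fits (next_phase (?m mod 3)) (tl (block (?m mod 3) (bits ?m)))
        (map letters [Suc ?i..<Suc ?i + l])"
      using Suc.IH[of 1 ?m] by (simp add: r next_phase_mod_3 drop_Suc)
    then have "fits (?m mod 3) [] (letters ?i # map letters [Suc ?i..<Suc ?i + l])"
      using hd by (cases "bits ?m") simp_all
    then show ?thesis
      unfolding map by (simp add: r)
  qed
qed simp

text \<open>A computable over-approximation of being a factor of \<open>letters\<close>: the bits of
  the blocks are left free. Its failure proves that \<open>v\<close> is not a factor.\<close>

definition occurs :: "letter list \<Rightarrow> bool" where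
  "occurs v \<longleftrightarrow> \<not> list_all (\<lambda>c. list_all
    (all_drops 20 (\<lambda>_ u. \<not> fits (next_phase c) u v)) [block c False, block c True]) phases"

section \<open>Factors of infinite words\<close>

lemma is_factor_iff: "is_factor u w \<longleftrightarrow> (\<exists>i. u = map w [i..<i + length u])"
proof
  assume "is_factor u w"
  then obtain i j where u: "u = map w [i..<j]"
    by (auto simp: is_factor_def subsequence_def)
  show "\<exists>i. u = map w [i..<i + length u]"
  proof (cases "i \<le> j")
    case True
    then show ?thesis
      using u by (intro exI[of _ i]) simp
  qed (use u in simp)
qed (auto simp: is_factor_def subsequence_def)

lemma is_factor_append: "is_factor (u @ v @ v') w \<Longrightarrow> is_factor v w"
proof -
  assume "is_factor (u @ v @ v') w"
  then obtain i where "u @ v @ v' = map w [i..<i + length (u @ v @ v')]"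
    unfolding is_factor_iff by blast
  then have "take (length v) (drop (length u) (u @ v @ v')) =
      take (length v) (drop (length u) (map w [i..<i + length (u @ v @ v')]))"
    by simp
  then have "v = map w [i + length u..<i + length u + length v]"
    by (simp add: take_map drop_map add.assoc)
  then show ?thesis
    unfolding is_factor_iff by blast
qed

lemma is_factor_nth:
  assumes "u = map w [i..<i + length u]" "t < length u"
  shows "u ! t = w (i + t)"
  using assms(2) by (subst assms(1)) simp

lemma is_factor_repeats:
  assumes "is_factor (x @ v @ x) w"
  obtains i where "repeats w (length x + length v) (length x) i"
    "x @ v @ x = map w [i..<i + length (x @ v @ x)]"
proof -
  obtain i where i: "x @ v @ x = map w [i..<i + length (x @ v @ x)]"
    using assms unfolding is_factor_iff by blast
  have "w (i + t) = w (i + (length x + length v) + t)" if "t < length x" for t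
    using that is_factor_nth[OF i, of t] is_factor_nth[OF i, of "length x + length v + t"]
    by (simp add: nth_append add.assoc)
  then show thesis
    using that i by (auto simp: repeats_def)
qed

lemma occurs_if_is_factor:
  assumes "is_factor v letters"
  shows "occurs v"
  unfolding occurs_def
proof
  obtain i where v: "v = map letters [i..<i + length v]"
    using assms unfolding is_factor_iff by blast
  let ?c = "i div 20 mod 3" and ?b = "bits (i div 20)"
  assume "list_all (\<lambda>c. list_all
    (all_drops 20 (\<lambda>_ u. \<not> fits (next_phase c) u v)) [block c False, block c True]) phases"
  then have "all_drops 20 (\<lambda>_ u. \<not> fits (next_phase ?c) u v) (block ?c ?b)"
    using mod_3_in_phases[of "i div 20"] by (cases ?b) (auto simp: list_all_iff)
  from all_dropsD[OF this, of "i mod 20"]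
  have "\<not> fits (Suc (i div 20) mod 3) (drop (i mod 20) (block ?c ?b)) v"
    by (simp add: next_phase_mod_3)
  moreover have "fits (Suc (i div 20) mod 3) (drop (i mod 20) (block ?c ?b)) v"
    using fits_letters[of "i mod 20" "i div 20" "length v"] v by simp
  ultimately show False
    by simp
qed

section \<open>Long repetitions\<close>

lemma sync_check:
  "all_windows 2 (\<lambda>c r u. let v = take 18 u in
    list_all (\<lambda>c'. list_all (all_drops 20
      (\<lambda>r' u'. if fits (next_phase c') u' v then r = r' \<and> c = c' else True))
      [block c' False, block c' True]) phases)"
  by code_simp

lemma letters_sync:
  assumes "repeats letters p 18 i"
  shows "60 dvd p"
proof -
  let ?j = "i + p"
  let ?c = "?j div 20 mod 3" and ?b = "bits (?j div 20)"
  obtain u where u: "list_all (\<lambda>c'. list_all (all_drops 20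
      (\<lambda>r' u'. if fits (next_phase c') u' (take 18 u)
        then 19 - i mod 20 = r' \<and> i div 20 mod 3 = c' else True))
      [block c' False, block c' True]) phases"
    and len: "21 \<le> length u" and nth: "\<And>t. t < 21 \<Longrightarrow> u ! t = letters (i + t)"
    by (rule all_windowsE[OF sync_check, where i = i]) (simp add: Let_def)
  have "all_drops 20 (\<lambda>r' u'. if fits (next_phase ?c) u' (take 18 u)
        then 19 - i mod 20 = r' \<and> i div 20 mod 3 = ?c else True) (block ?c ?b)"
    using u mod_3_in_phases[of "?j div 20"] by (cases ?b) (auto simp: list_all_iff)
  from all_dropsD[OF this, of "?j mod 20"]
  have *: "fits (Suc (?j div 20) mod 3) (drop (?j mod 20) (block ?c ?b)) (take 18 u) \<Longrightarrow>
      19 - i mod 20 = 19 - ?j mod 20 \<and> i div 20 mod 3 = ?c"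
    by (simp add: next_phase_mod_3 split: if_splits)
  have "take 18 u = map letters [?j..<?j + 18]"
    using assms len by (intro nth_equalityI) (simp_all add: nth repeats_def)
  then have "19 - i mod 20 = 19 - ?j mod 20 \<and> i div 20 mod 3 = ?c"
    using fits_letters[of "?j mod 20" "?j div 20" 18] by (intro *) simp
  moreover have "i mod 20 < 20" "?j mod 20 < 20"
    by simp_all
  ultimately have "i mod 20 = ?j mod 20" "i div 20 mod 3 = ?c"
    by linarith+
  \<comment> \<open>Offset modulo 20 and phase modulo 3 together are the residue modulo 60.\<close>
  then have "i mod (20 * 3) = ?j mod (20 * 3)"
    unfolding mod_mult2_eq by simp
  then show ?thesis
    using mod_eq_dvd_iff_nat[of i ?j 60] by simp
qed

text \<open>In a known phase, the bit can thus be read from the first 7 letters of its block as well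
  as from the last 2.\<close>

lemma block_differs_check:
  "list_all (\<lambda>c. \<not> agree 7 (block c False) (block c True) \<and>
    \<not> agree 2 (drop 18 (block c False)) (drop 18 (block c True))) phases"
  by code_simp

lemma block_differs:
  assumes "(m, l) = (0, 7) \<or> (m, l) = (18, 2)"
    and eq: "\<And>r. m \<le> r \<Longrightarrow> r < m + l \<Longrightarrow> block (n mod 3) b ! r = block (n mod 3) b' ! r"
  shows "b = b'"
proof (rule ccontr)
  assume "b \<noteq> b'"
  then have "block (n mod 3) False ! r = block (n mod 3) True ! r" if "m \<le> r" "r < m + l" for r
    using eq[OF that] by (cases b; cases b') simp_all
  then have "agree l (drop m (block (n mod 3) False)) (drop m (block (n mod 3) True))"
    using assms(1) by (intro agree_if_nth_eq) auto
  then show False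
    using block_differs_check mod_3_in_phases[of n] assms(1) by (auto simp: list_all_iff)
qed

text \<open>The worst case is \<open>i = 20 * n - 1\<close>: one letter is wasted, then
  \<open>k - 1\<close> full blocks and 7 letters of the last one are needed, which makes
  \<open>20 * k - 12\<close> letters.\<close>

lemma letters_desubstitute:
  assumes "repeats letters (20 * p) a i" "3 dvd p" "2 \<le> k" "20 * k \<le> a + 12"
  obtains n where "repeats bits p k n"
proof -
  have letters_eq: "block (n mod 3) (bits n) ! r = block (n mod 3) (bits (n + p)) ! r"
    if "i \<le> 20 * n + r" "20 * n + r < i + a" "r < 20" for n r
  proof -
    have "letters (20 * n + r) = letters (20 * (n + p) + r)"
      using assms(1)[unfolded repeats_def, rule_format, of "20 * n + r - i"] that
      by (simp add: algebra_simps)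
    moreover have "(n + p) mod 3 = n mod 3"
      using assms(2) by (auto elim: dvdE)
    ultimately show ?thesis
      using that(3) by (simp add: letters_uniform del: distrib_left_numeral)
  qed
  have start: "bits n = bits (n + p)" if "i \<le> 20 * n" "20 * n + 6 < i + a" for n
    by (rule block_differs[of 0 7 n]) (use that in \<open>auto intro!: letters_eq\<close>)
  have stop: "bits n = bits (n + p)" if "i \<le> 20 * n + 18" "20 * n + 19 < i + a" for n
    by (rule block_differs[of 18 2 n]) (use that in \<open>auto intro!: letters_eq\<close>)
  \<comment> \<open>Adding 1 skips a block of which only the last letter is in the range, too little
    to read its bit.\<close>
  define n where "n = (i + 1) div 20"
  have n: "20 * n \<le> i + 1" "i + 1 < 20 * n + 20"
    unfolding n_def by linarith+
  have "bits (n + t) = bits (n + p + t)" if "t < k" for t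
  \<comment> \<open>Block \<open>n\<close> may begin before \<open>i\<close>; its bit is then read
    at its end. All other blocks are read at their start.\<close>
  proof (cases "t = 0 \<and> 20 * n \<noteq> i + 1")
    case True
    then show ?thesis
      using stop[of n] n assms(3,4) by simp
  next
    case False
    then have "i \<le> 20 * (n + t)"
      using n by (cases t) simp_all
    moreover have "20 * t + 20 \<le> 20 * k"
      using that by simp
    then have "20 * (n + t) + 6 < i + a"
      using assms(4) n by simp
    ultimately show ?thesis
      using start[of "n + t"] by (simp add: ac_simps)
  qed
  then show thesis
    using that[of n] by (simp add: repeats_def)
qed

text \<open>In \<open>scan\<close> the periods \<open>2 * h + 3\<close> and \<open>2 * h + 4\<close> are treated together because \<open>h\<close> is
  for both the least \<open>a\<close> with \<open>2 * a + 4 \<ge> p\<close>.\<close>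

fun scan :: "(nat \<Rightarrow> bool) \<Rightarrow> nat \<Rightarrow> nat \<Rightarrow> 'a list \<Rightarrow> 'a list \<Rightarrow> bool" where
  "scan Q 0 h u d = True"
| "scan Q (Suc k) h u d =
    (if (if agree h u d then Q (2 * h + 3) else True) then
      if (if agree h u (tl d) then Q (2 * h + 4) else True) then scan Q k (Suc h) u (tl (tl d))
      else False
    else False)"

lemma scanD:
  assumes "scan Q k h u (drop (2 * h + 3) u)" "2 * h + 3 \<le> p" "p < 2 * (h + k) + 3"
    "agree ((p - 3) div 2) u (drop p u)"
  shows "Q p"
  using assms
proof (induction k arbitrary: h)
  case (Suc k)
  have "tl (drop m u) = drop (Suc m) u" for m
    by (simp add: drop_Suc tl_drop)
  from this[of "2 * h + 3"] this[of "2 * h + 4"]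
  have tl: "tl (drop (2 * h + 3) u) = drop (2 * h + 4) u"
    "tl (drop (2 * h + 4) u) = drop (2 * Suc h + 3) u"
    by (simp_all add: eval_nat_numeral)
  have "p = 2 * h + 3 \<or> p = 2 * h + 4 \<or> 2 * Suc h + 3 \<le> p"
    using Suc.prems(2) by arith
  then consider "p = 2 * h + 3" | "p = 2 * h + 4" | "2 * Suc h + 3 \<le> p"
    by blast
  then show ?case
  proof cases
    case 1
    then show ?thesis
      using Suc.prems(1,4) by (simp split: if_splits)
  next
    case 2
    then have "(p - 3) div 2 = h"
      by simp
    then show ?thesis
      using Suc.prems(1,4) 2 by (simp add: tl(1) split: if_splits)
  next
    case 3
    have "scan Q k (Suc h) u (drop (2 * Suc h + 3) u)"
      using Suc.prems(1) by (simp only: scan.simps tl split: if_splits)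
    then show ?thesis
      using Suc.IH[of "Suc h"] 3 Suc.prems(3,4) by simp
  qed
qed simp

lemma repeats_agree:
  assumes "repeats f p a i" "\<And>t. t < l \<Longrightarrow> u ! t = f (i + t)" "l \<le> length u" "p + a \<le> l"
  shows "agree a u (drop p u)"
  using assms by (intro agree_if_nth_eq) (simp_all add: repeats_def add.assoc)

text \<open>The periods are 19 to 38. A pair of maximal length takes 38 + 17 = 55 letters, and four
  blocks guarantee 61.\<close>

lemma middle_check: "all_windows 4 (\<lambda>c r u. scan (\<lambda>_. False) 10 8 u (drop 19 u))"
  by code_simp

text \<open>Periods divisible by 60 descend to \<open>bits\<close>. For all others synchronisation
  gives \<open>a < 18\<close>, so a counterexample has a period inspected by
  \<open>middle_check\<close>.\<close>

lemma letters_repetition_short: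
  assumes "repeats letters p a i" "19 \<le> p"
  shows "2 * a + 4 < p"
proof (rule ccontr)
  assume long: "\<not> 2 * a + 4 < p"
  show False
  proof (cases "60 dvd p")
    case True
    then obtain q where q: "p = 20 * (3 * q)"
      by (auto elim: dvdE)
    \<comment> \<open>Half of \<open>3 * q\<close>, rounded up: enough to contradict
      \<open>bits_repetition_short\<close>, while
      \<open>20 * ?k \<le> 30 * q + 10 \<le> a + 12\<close>.\<close>
    let ?k = "(3 * q + 1) div 2"
    have "0 < q"
      using assms(2) q by simp
    moreover have k: "3 * q \<le> 2 * ?k" "2 * ?k \<le> 3 * q + 1"
      by linarith+
    ultimately have "2 \<le> ?k" "20 * ?k \<le> a + 12"
      using long q by linarith+
    then obtain n where "repeats bits (3 * q) ?k n"
      using letters_desubstitute[of "3 * q" a i ?k] assms(1) q by auto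
    then show False
      using bits_repetition_short[of "3 * q" ?k n] k(1) \<open>0 < q\<close> by simp
  next
    case False
    have "a < 18"
      using False letters_sync repeats_mono[OF assms(1), of 18] by (meson not_le)
    then have p: "p \<le> 38"
      using long by simp
    obtain u where u: "scan (\<lambda>_. False) 10 8 u (drop 19 u)" "61 \<le> length u"
      "\<And>t. t < 61 \<Longrightarrow> u ! t = letters (i + t)"
      by (rule all_windowsE[OF middle_check, where i = i]) simp
    let ?h = "(p - 3) div 2"
    have "?h \<le> a" "p + ?h \<le> 61"
      using long p by linarith+
    then have "agree ?h u (drop p u)"
      using repeats_agree[OF repeats_mono[OF assms(1)] u(3,2)] by blast
    then show False
      using scanD[of "\<lambda>_. False" 10 8 u p] u(1) assms(2) p by simp
  qed
qed

section \<open>Short repetitions\<close>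

text \<open>\<open>v\<close> and \<open>v'\<close> are the other fragment with \<open>z\<close> and
  with its reversal, so that one test serves both formulas.\<close>

definition excluded :: "letter list \<Rightarrow> letter list \<Rightarrow> letter list \<Rightarrow> bool" where
  "excluded v v' z =
    (if occurs v then \<not> occurs (rev z) else if occurs v' then \<not> occurs (rev z) else True)"

text \<open>The prefix of \<open>u\<close> of length \<open>m + n + c\<close> is read both as \<open>xyz\<close>, and then \<open>yzxy\<close> and its
  variant must not occur, and as \<open>yzx\<close>, with \<open>m\<close> the length of \<open>y\<close>.\<close>

definition split_ok :: "letter list \<Rightarrow> nat \<Rightarrow> nat \<Rightarrow> nat \<Rightarrow> bool" where
  "split_ok u m n c =
    (let v = take m u; s = take n (drop m u); z = take c (drop (m + n) u);
         z' = take c (drop m u); s' = take n (drop (m + c) u) in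
      if excluded (s @ z @ v @ s) (s @ rev z @ v @ s) z
      then excluded (s' @ v @ z' @ s') (s' @ v @ rev z' @ s') z' else False)"

text \<open>Here \<open>m\<close> is the length of the longer of x and y, \<open>n\<close> that of
  the other, and \<open>c\<close> that of z, at most 4 by \<open>reversible_short\<close>. Truncated
  subtraction sends \<open>m + c \<ge> p\<close> to \<open>n = 0\<close>, which is skipped.\<close>

definition period_ok :: "letter list \<Rightarrow> nat \<Rightarrow> bool" where
  "period_ok u p = list_all (\<lambda>m. if agree m u (drop p u) then
      list_all (\<lambda>c. let n = p - (m + c) in
        if n = 0 then True else if n \<le> m then split_ok u m n c else True) [1, 2, 3, 4]
    else True) [1..<p]"

text \<open>Periods 3 to 10 fit into the 21 letters that two blocks guarantee;
  \<open>short_check_18\<close> treats 11 to 18 with three blocks.\<close>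

lemma short_check_10: "all_windows 2 (\<lambda>c r u. scan (period_ok u) 4 0 u (drop 3 u))"
  by code_simp

lemma short_check_18: "all_windows 3 (\<lambda>c r u. scan (period_ok u) 4 4 u (drop 11 u))"
  by code_simp

lemma reversal_check: "all_windows 2 (\<lambda>c r u. \<not> occurs (rev (take 5 u)))"
  by code_simp

lemma reversible_short:
  assumes "is_factor z letters" "is_factor (rev z) letters"
  shows "length z \<le> 4"
proof (rule ccontr)
  assume "\<not> length z \<le> 4"
  then have len: "5 \<le> length z"
    by simp
  have "is_factor (take 5 z) letters"
    using is_factor_append[of "[]" "take 5 z" "drop 5 z"] assms(1) by simp
  then obtain i where i: "take 5 z = map letters [i..<i + 5]"
    using len unfolding is_factor_iff by auto
  obtain u where u: "\<not> occurs (rev (take 5 u))" "21 \<le> length u"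
    "\<And>t. t < 21 \<Longrightarrow> u ! t = letters (i + t)"
    by (rule all_windowsE[OF reversal_check, where i = i]) simp
  have "take 5 u = take 5 z"
    unfolding i using u(2,3) by (intro nth_equalityI) simp_all
  moreover have "rev z = rev (drop 5 z) @ rev (take 5 z) @ []"
    by (metis append_Nil2 append_take_drop_id rev_append)
  then have "is_factor (rev (take 5 z)) letters"
    using is_factor_append[of "rev (drop 5 z)" "rev (take 5 z)" "[]"] assms(2) by simp
  ultimately show False
    using occurs_if_is_factor u(1) by simp
qed

lemma period_ok_split:
  assumes "period_ok u (m + n + c)" "agree m u (drop (m + n + c) u)" "0 < n" "n \<le> m"
    "c \<in> {1, 2, 3, 4}"
  shows "split_ok u m n c"
proof -
  have "m \<in> set [1..<m + n + c]"
    using assms(3-5) by auto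
  from bspec[OF assms(1)[unfolded period_ok_def list_all_iff] this]
  have "\<forall>c'\<in>set [1, 2, 3, 4]. let n' = m + n + c - (m + c') in
      if n' = 0 then True else if n' \<le> m then split_ok u m n' c' else True"
    using assms(2) by (simp only: if_True)
  then have "let n' = m + n + c - (m + c) in
        if n' = 0 then True else if n' \<le> m then split_ok u m n' c else True"
    by (rule bspec) (use assms(5) in simp)
  then show ?thesis
    using assms(3,4) by (simp add: Let_def)
qed

text \<open>Since \<open>n \<le> length v\<close> and \<open>c \<le> 4\<close>, the period is at
  most \<open>2 * length v + 4\<close>, so \<open>scan\<close> has inspected it. The inspected
  window begins with the given factor, and \<open>u'\<close> is its remainder.\<close>

lemma short_repetition_split:
  assumes "is_factor (v @ q @ v) letters" "length q = n + c"
    "length v + n + c \<le> 18" "0 < n" "n \<le> length v" "c \<in> {1, 2, 3, 4}"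
  obtains u' where "split_ok (v @ q @ v @ u') (length v) n c"
proof -
  let ?m = "length v"
  let ?p = "?m + n + c"
  obtain i where rep: "repeats letters ?p ?m i"
    and i: "v @ q @ v = map letters [i..<i + length (v @ q @ v)]"
    using is_factor_repeats[OF assms(1)] assms(2) by (metis add.assoc)
  have "\<exists>u l. period_ok u ?p \<and> ?p + ?m \<le> l \<and> l \<le> length u \<and>
      (\<forall>t<l. u ! t = letters (i + t))"
  proof (cases "?p \<le> 10")
    case True
    obtain u where u: "scan (period_ok u) 4 0 u (drop 3 u)" "21 \<le> length u"
      "\<And>t. t < 21 \<Longrightarrow> u ! t = letters (i + t)"
      by (rule all_windowsE[OF short_check_10, where i = i]) simp
    have "(?p - 3) div 2 \<le> ?m" "?p + (?p - 3) div 2 \<le> 21"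
      using assms(5,6) True by auto
    then have "agree ((?p - 3) div 2) u (drop ?p u)"
      using repeats_agree[OF repeats_mono[OF rep] u(3,2)] by blast
    then have "period_ok u ?p"
      using scanD[of "period_ok u" 4 0 u ?p] u(1) True assms(4-6) by auto
    then show ?thesis
      using u(2,3) True assms(6) by (intro exI[of _ u] exI[of _ 21]) auto
  next
    case False
    obtain u where u: "scan (period_ok u) 4 4 u (drop 11 u)" "41 \<le> length u"
      "\<And>t. t < 41 \<Longrightarrow> u ! t = letters (i + t)"
      by (rule all_windowsE[OF short_check_18, where i = i]) simp
    have "(?p - 3) div 2 \<le> ?m" "?p + (?p - 3) div 2 \<le> 41"
      using assms(3,5,6) by auto
    then have "agree ((?p - 3) div 2) u (drop ?p u)"
      using repeats_agree[OF repeats_mono[OF rep] u(3,2)] by blast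
    then have "period_ok u ?p"
      using scanD[of "period_ok u" 4 4 u ?p] u(1) False assms(3) by auto
    then show ?thesis
      using u(2,3) assms(3) by (intro exI[of _ u] exI[of _ 41]) auto
  qed
  then obtain u l where u: "period_ok u ?p" "?p + ?m \<le> l" "l \<le> length u"
    and nth: "\<And>t. t < l \<Longrightarrow> u ! t = letters (i + t)"
    by blast
  have "agree ?m u (drop ?p u)"
    using repeats_agree[OF rep nth u(3,2)] .
  then have ok: "split_ok u ?m n c"
    using period_ok_split[OF u(1)] assms(4-6) by blast
  have "take (?p + ?m) u = map letters [i..<i + (?p + ?m)]"
    using u(2,3) by (intro nth_equalityI) (simp_all add: nth)
  moreover have "length (v @ q @ v) = ?p + ?m"
    using assms(2) by simp
  ultimately have "take (?p + ?m) u = v @ q @ v"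
    using i by metis
  then have "u = v @ q @ v @ drop (?p + ?m) u"
    by (metis append_assoc append_take_drop_id)
  then show thesis
    using ok that by metis
qed

section \<open>Excluding both formulas at once\<close>

lemma not_excluded:
  assumes "is_factor v letters \<or> is_factor v' letters" "is_factor (rev z) letters"
  shows "\<not> excluded v v' z"
  using assms occurs_if_is_factor by (auto simp: excluded_def)

text \<open>For \<open>?p \<ge> 19\<close> the bounds on x and y add up to
  \<open>length x + length y + 4 < ?p\<close>, which contradicts \<open>length z \<le> 4\<close>.
  For smaller \<open>?p\<close> the fragment that begins and ends with the longer of x and y is a
  repetition covered by \<open>short_repetition_split\<close>.\<close>

lemma no_pattern:
  assumes ne: "x \<noteq> []" "y \<noteq> []" "z \<noteq> []"
    and xyzx: "is_factor (x @ y @ z @ x) letters"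
    and yzxy: "is_factor (y @ z' @ x @ y) letters"
    and z': "z' = z \<or> z' = rev z"
    and rev_z: "is_factor (rev z) letters"
  shows False
proof -
  have z: "is_factor z letters"
    using is_factor_append[of "x @ y" z x] xyzx by simp
  have len_z': "length z' = length z"
    using z' by auto
  have c4: "length z \<le> 4"
    by (rule reversible_short[OF z rev_z])
  let ?p = "length x + length y + length z"
  show False
  proof (cases "19 \<le> ?p")
    case True
    obtain i where "repeats letters ?p (length x) i"
      using is_factor_repeats[of x "y @ z"] xyzx by (metis append_assoc length_append add.assoc)
    then have "2 * length x + 4 < ?p"
      by (rule letters_repetition_short[OF _ True])
    moreover obtain j where "repeats letters ?p (length y) j"
      using is_factor_repeats[of y "z' @ x"] yzxy len_z'
      by (metis append_assoc length_append add.assoc add.commute)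
    then have "2 * length y + 4 < ?p"
      by (rule letters_repetition_short[OF _ True])
    ultimately show False
      using c4 by simp
  next
    case False
    have c: "length z \<in> {1, 2, 3, 4}"
      using c4 ne(3) by (cases "length z") auto
    show False
    proof (cases "length y \<le> length x")
      case True
      obtain u where "split_ok (x @ (y @ z) @ x @ u) (length x) (length y) (length z)"
        by (rule short_repetition_split[of x "y @ z" "length y" "length z"])
          (use xyzx False True c ne in auto)
      then have "excluded (y @ z @ x @ y) (y @ rev z @ x @ y) z"
        by (simp add: split_ok_def Let_def split: if_splits)
      then show False
        using not_excluded[of "y @ z @ x @ y" "y @ rev z @ x @ y" z] yzxy z' rev_z by auto
    next
      case y: False
      \<comment> \<open>With the roles of the fragments exchanged, the reversal of \<open>z'\<close>
        must occur; it is z or its reversal, and both do.\<close>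
      have "is_factor (rev z') letters"
        using z' z rev_z by auto
      obtain u where "split_ok (y @ (z' @ x) @ y @ u) (length y) (length x) (length z')"
        by (rule short_repetition_split[of y "z' @ x" "length x" "length z'"])
          (use yzxy False y c ne len_z' in auto)
      then have "excluded (x @ y @ z' @ x) (x @ y @ rev z' @ x) z'"
        by (simp add: split_ok_def Let_def split: if_splits)
      then show False
        using not_excluded[of "x @ y @ z' @ x" "x @ y @ rev z' @ x" z'] xyzx z'
          \<open>is_factor (rev z') letters\<close> by auto
    qed
  qed
qed

section \<open>Recoding over the alphabet {0, 1, 2}\<close>

fun letter_code :: "letter \<Rightarrow> nat" where
  "letter_code A = 0"
| "letter_code B = 1"
| "letter_code C = 2"

lemma inj_letter_code: "inj letter_code"
proof
  show "x = y" if "letter_code x = letter_code y" for x y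
    using that by (cases x; cases y) simp_all
qed

lemma is_factor_decode:
  assumes "is_factor u (letter_code \<circ> letters)"
  shows "is_factor (map (inv letter_code) u) letters"
proof -
  obtain i where "u = map (letter_code \<circ> letters) [i..<i + length u]"
    using assms unfolding is_factor_iff by blast
  then have "map (inv letter_code) u =
      map (inv letter_code) (map (letter_code \<circ> letters) [i..<i + length u])"
    by simp
  then have "map (inv letter_code) u = map letters [i..<i + length u]"
    by (simp add: inv_f_f[OF inj_letter_code] comp_def)
  then show ?thesis
    unfolding is_factor_iff by auto
qed

theorem theorem3:
  shows "\<exists>w :: nat word. range w \<subseteq> {0, 1, 2} \<and> avoids w formula_A \<and> avoids w formula_B"
proof (intro exI conjI)
  let ?w = "letter_code \<circ> letters"
  let ?d = "map (inv letter_code)"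
  show "range ?w \<subseteq> {0, 1, 2}"
  proof (rule image_subsetI)
    show "?w n \<in> {0, 1, 2}" for n
      by (cases "letters n") simp_all
  qed
  show "avoids ?w formula_A"
    unfolding avoids_def
  proof
    assume "\<exists>h. is_occurrence h formula_A ?w"
    then obtain h where h: "\<And>v. h v \<noteq> []"
      "is_factor (h X @ h Y @ h Z @ h X) ?w" "is_factor (h Y @ h Z @ h X @ h Y) ?w"
      "is_factor (rev (h Z)) ?w"
      by (auto simp: is_occurrence_def formula_A_def subst_fragment_def)
    show False
      using no_pattern[of "?d (h X)" "?d (h Y)" "?d (h Z)" "?d (h Z)"] h(1)
        is_factor_decode[OF h(2)] is_factor_decode[OF h(3)] is_factor_decode[OF h(4)]
      by (simp add: rev_map)
  qed
  show "avoids ?w formula_B"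
    unfolding avoids_def
  proof
    assume "\<exists>h. is_occurrence h formula_B ?w"
    then obtain h where h: "\<And>v. h v \<noteq> []"
      "is_factor (h X @ h Y @ h Z @ h X) ?w" "is_factor (h Y @ rev (h Z) @ h X @ h Y) ?w"
      by (auto simp: is_occurrence_def formula_B_def subst_fragment_def)
    \<comment> \<open>What is a separate fragment in \<open>formula_A\<close> lies inside the second
      fragment here.\<close>
    have "is_factor (rev (h Z)) ?w"
      using is_factor_append[of "h Y" "rev (h Z)" "h X @ h Y"] h(3) by simp
    then show False
      using no_pattern[of "?d (h X)" "?d (h Y)" "?d (h Z)" "?d (rev (h Z))"] h(1)
        is_factor_decode[OF h(2)] is_factor_decode[OF h(3)] is_factor_decode[of "rev (h Z)"]
      by (simp add: rev_map)
  qed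
qed

end
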